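(* Let $X$ be a real Banach space with $\dim X\geqslant 2$. Then for every $t\in[0,\frac12)$, $$L_X(t)\geqslant(4t^2-4t+1)\,C_{\mathrm{NJ}}^{\prime}(X).$$
   Context: For $x,y$ in a real Banach space $X$, isosceles orthogonality $x\perp_I y$ means $\|x+y\|=\|x-y\|$. For $0\leqslant t<\frac12$ define $$L_X(t)=\sup\left\{\frac{\|tx+(1-t)y\|^2+\|(1-t)x+ty\|^2}{\|x+y\|^2}: x,y\in X,\ (x,y)\neq(0,0),\ x\perp_I y\right\}.$$ Let $S_X=\{x\in X:\|x\|=1\}$. The modified von Neumann-Jordan constant is $$C_{\mathrm{NJ}}^{\prime}(X)=\sup\left\{\frac{\|x+y\|^2+\|x-y\|^2}{4}: x,y\in S_X\right\}.$$ *)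

theory Defs
  imports "HOL-Analysis.Analysis"
begin

definition isosceles_orthogonal :: "'a::real_normed_vector \<Rightarrow> 'a \<Rightarrow> bool"
    (infix "\<bottom>\<^sub>I" 50)
  where "x \<bottom>\<^sub>I y \<longleftrightarrow> norm (x + y) = norm (x - y)"

text \<open>
  The space \<open>X\<close> is the whole type \<open>'a\<close>, passed as \<open>TYPE('a)\<close>. The suprema below are taken
  in the reals; the lemmas after the definitions show that the sets are bounded above, and
  nonempty if \<open>X\<close> is not \<open>{0}\<close>. Division by zero does not occur in \<open>L_set\<close>: if
  \<open>x \<bottom>\<^sub>I y\<close> and \<open>x + y = 0\<close>, then also \<open>x - y = 0\<close>, so \<open>x = y = 0\<close>.
\<close>

definition L_set :: "'a::real_normed_vector itself \<Rightarrow> real \<Rightarrow> real set"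
  where "L_set _ t =
    {((norm (t *\<^sub>R x + (1 - t) *\<^sub>R y))\<^sup>2 + (norm ((1 - t) *\<^sub>R x + t *\<^sub>R y))\<^sup>2)
        / (norm (x + y))\<^sup>2
      | x y :: 'a. (x, y) \<noteq> (0, 0) \<and> x \<bottom>\<^sub>I y}"

definition L_const :: "'a::real_normed_vector itself \<Rightarrow> real \<Rightarrow> real"
  where "L_const X t = Sup (L_set X t)"

definition CNJ'_set :: "'a::real_normed_vector itself \<Rightarrow> real set"
  where "CNJ'_set _ =
    {((norm (x + y))\<^sup>2 + (norm (x - y))\<^sup>2) / 4
      | x y :: 'a. x \<in> sphere 0 1 \<and> y \<in> sphere 0 1}"

definition CNJ' :: "'a::real_normed_vector itself \<Rightarrow> real"
  where "CNJ' X = Sup (CNJ'_set X)"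

text \<open>
  The library's \<open>dim\<close> is \<open>0\<close> on infinite-dimensional spaces, so a lower bound on the
  dimension is expressed by a linearly independent set of that size.
\<close>

definition dim_at_least :: "'a::real_vector itself \<Rightarrow> nat \<Rightarrow> bool"
  where "dim_at_least _ n \<longleftrightarrow> (\<exists>B :: 'a set. finite B \<and> card B = n \<and> independent B)"

lemma isosceles_orthogonal_sum_nonzero:
  fixes x y :: "'a::real_normed_vector"
  assumes "x \<bottom>\<^sub>I y" "(x, y) \<noteq> (0, 0)"
  shows "x + y \<noteq> 0"
proof
  assume s: "x + y = 0"
  then have "x - y = 0"
    using assms(1) by (simp add: isosceles_orthogonal_def)
  with s have "2 *\<^sub>R x = 0"
    by (simp add: scaleR_2)
  with \<open>x - y = 0\<close> assms(2) show False
    by simp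
qed

lemma bdd_above_L_set:
  assumes "0 \<le> t" "t < 1/2"
  shows "bdd_above (L_set TYPE('a::real_normed_vector) t)"
proof (rule bdd_aboveI)
  fix r
  assume "r \<in> L_set TYPE('a) t"
  then obtain x y :: 'a where o: "x \<bottom>\<^sub>I y" "(x, y) \<noteq> (0, 0)"
    and r: "r = ((norm (t *\<^sub>R x + (1 - t) *\<^sub>R y))\<^sup>2
      + (norm ((1 - t) *\<^sub>R x + t *\<^sub>R y))\<^sup>2) / (norm (x + y))\<^sup>2"
    by (auto simp: L_set_def)
  have e: "norm (x - y) = norm (x + y)"
    using o(1) by (simp add: isosceles_orthogonal_def)
  have pos: "norm (x + y) > 0"
    using isosceles_orthogonal_sum_nonzero[OF o] by simp
  have "2 *\<^sub>R x = (x + y) + (x - y)" "2 *\<^sub>R y = (x + y) - (x - y)"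
    by (simp_all add: scaleR_2)
  then have "norm (2 *\<^sub>R x) \<le> norm (x + y) + norm (x - y)"
    "norm (2 *\<^sub>R y) \<le> norm (x + y) + norm (x - y)"
    by (metis norm_triangle_ineq, metis norm_triangle_ineq4)
  then have n: "norm x \<le> norm (x + y)" "norm y \<le> norm (x + y)"
    using e by simp_all
  have b: "norm (a *\<^sub>R x + c *\<^sub>R y) \<le> norm (x + y)"
    if "0 \<le> a" "0 \<le> c" "a + c = 1" for a c
  proof -
    have "norm (a *\<^sub>R x + c *\<^sub>R y) \<le> a * norm x + c * norm y"
      using norm_triangle_ineq[of "a *\<^sub>R x" "c *\<^sub>R y"] that by simp
    also have "\<dots> \<le> norm (x + y)"
      using n that by (intro convex_bound_le) auto
    finally show ?thesis .
  qed
  have "(norm (t *\<^sub>R x + (1 - t) *\<^sub>R y))\<^sup>2 \<le> (norm (x + y))\<^sup>2"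
    "(norm ((1 - t) *\<^sub>R x + t *\<^sub>R y))\<^sup>2 \<le> (norm (x + y))\<^sup>2"
    using b[of t "1 - t"] b[of "1 - t" t] assms by (simp_all add: power_mono)
  then have "(norm (t *\<^sub>R x + (1 - t) *\<^sub>R y))\<^sup>2
      + (norm ((1 - t) *\<^sub>R x + t *\<^sub>R y))\<^sup>2 \<le> 2 * (norm (x + y))\<^sup>2"
    by linarith
  then show "r \<le> 2"
    using pos unfolding r by (subst pos_divide_le_eq) auto
qed

lemma L_set_nonempty:
  assumes "\<exists>x :: 'a::real_normed_vector. x \<noteq> 0"
  shows "L_set TYPE('a) t \<noteq> {}"
proof -
  obtain x :: 'a where "x \<noteq> 0"
    using assms by blast
  then have "(x, 0) \<noteq> (0, 0) \<and> x \<bottom>\<^sub>I 0"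
    by (simp add: isosceles_orthogonal_def)
  then show ?thesis
    unfolding L_set_def by blast
qed

lemma bdd_above_CNJ'_set: "bdd_above (CNJ'_set TYPE('a::real_normed_vector))"
proof (rule bdd_aboveI)
  fix r
  assume "r \<in> CNJ'_set TYPE('a)"
  then obtain x y :: 'a where n: "norm x = 1" "norm y = 1"
    and r: "r = ((norm (x + y))\<^sup>2 + (norm (x - y))\<^sup>2) / 4"
    by (auto simp: CNJ'_set_def)
  have "(norm (x + y))\<^sup>2 \<le> 2\<^sup>2" "(norm (x - y))\<^sup>2 \<le> 2\<^sup>2"
    using norm_triangle_ineq[of x y] norm_triangle_ineq4[of x y] n
    by (intro power_mono; simp)+
  then show "r \<le> 2"
    by (simp add: r)
qed

lemma CNJ'_set_nonempty:
  assumes "\<exists>x :: 'a::real_normed_vector. x \<noteq> 0"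
  shows "CNJ'_set TYPE('a) \<noteq> {}"
proof -
  obtain x :: 'a where "x \<noteq> 0"
    using assms by blast
  then have "sgn x \<in> sphere 0 1"
    by (simp add: norm_sgn)
  then show ?thesis
    unfolding CNJ'_set_def by blast
qed

end

theory Submission
  imports Defs
begin

text \<open>
  Writing \<open>u = x + y\<close>, \<open>v = x - y\<close> and \<open>s = 1 - 2 * t\<close>, the elements of \<open>L_set\<close> obtained from
  unit vectors \<open>u\<close>, \<open>v\<close> are \<open>(\<parallel>u + s v\<parallel>\<^sup>2 + \<parallel>u - s v\<parallel>\<^sup>2) / 4\<close>.
  The vectors \<open>s (u + v)\<close> and \<open>s (u - v)\<close> are convex combinations, with weights
  \<open>(1 + s) / 2\<close> and \<open>(1 - s) / 2\<close> in opposite orders, of \<open>u + s v\<close> and \<open>u - s v\<close> up to sign, so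
  by convexity of the squared norm that element is at least \<open>s\<^sup>2\<close> times the element of
  \<open>CNJ'_set\<close> given by \<open>u\<close> and \<open>v\<close>.
\<close>

text \<open>The triangle inequality reduces this to convexity of squaring on the reals.\<close>

lemma norm_sq_convex_combination_le:
  fixes p q :: "'a::real_normed_vector"
  assumes "0 \<le> a" "0 \<le> b" "a + b = 1"
  shows "(norm (a *\<^sub>R p + b *\<^sub>R q))\<^sup>2 \<le> a * (norm p)\<^sup>2 + b * (norm q)\<^sup>2"
proof -
  have "norm (a *\<^sub>R p + b *\<^sub>R q) \<le> a * norm p + b * norm q"
    using norm_triangle_ineq[of "a *\<^sub>R p" "b *\<^sub>R q"] assms by simp
  then have "(norm (a *\<^sub>R p + b *\<^sub>R q))\<^sup>2 \<le> (a * norm p + b * norm q)\<^sup>2"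
    by (simp add: power_mono)
  also have "\<dots> \<le> a * (norm p)\<^sup>2 + b * (norm q)\<^sup>2"
  proof -
    have "a = 1 - b"
      using assms(3) by simp
    then show ?thesis
      using convex_onD[OF convex_power2, of b "norm p" "norm q"] assms(1,2) by simp
  qed
  finally show ?thesis .
qed

lemma scaled_norm_sq_sum_le:
  fixes u v :: "'a::real_normed_vector"
  assumes "0 \<le> s" "s \<le> 1"
  shows "s\<^sup>2 * ((norm (u + v))\<^sup>2 + (norm (u - v))\<^sup>2)
    \<le> (norm (u + s *\<^sub>R v))\<^sup>2 + (norm (u - s *\<^sub>R v))\<^sup>2"
proof -
  define a b where "a = (1 + s) / 2" and "b = (1 - s) / 2"
  have ab: "0 \<le> a" "0 \<le> b" "a + b = 1" "a - b = s"
    using assms by (simp_all add: a_def b_def field_simps)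
  let ?p = "u + s *\<^sub>R v" and ?q = "u - s *\<^sub>R v"
  \<comment> \<open>The sign of \<open>w\<close> is reversed in the second vector so that
    \<open>w\<close> gets the coefficient \<open>a - b = s\<close>, while \<open>z\<close> gets
    \<open>(a + b) * s = s\<close>.\<close>
  have combine: "a *\<^sub>R (w + s *\<^sub>R z) + b *\<^sub>R (s *\<^sub>R z - w) = s *\<^sub>R (w + z)" for w z :: 'a
  proof -
    have "a *\<^sub>R (w + s *\<^sub>R z) + b *\<^sub>R (s *\<^sub>R z - w) = (a - b) *\<^sub>R w + ((a + b) * s) *\<^sub>R z"
      by (simp add: algebra_simps)
    then show ?thesis
      using ab by (simp add: scaleR_add_right)
  qed
  have "s\<^sup>2 * (norm (u + v))\<^sup>2 \<le> a * (norm ?p)\<^sup>2 + b * (norm ?q)\<^sup>2"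
    using norm_sq_convex_combination_le[OF ab(1-3), of ?p "s *\<^sub>R v - u"] combine[of u v]
    by (simp add: power_mult_distrib norm_minus_commute)
  \<comment> \<open>Replacing \<open>v\<close> by \<open>- v\<close> swaps \<open>?p\<close> and
    \<open>?q\<close>, so in the sum of both bounds each squared norm has total weight
    \<open>a + b = 1\<close>.\<close>
  moreover have "s\<^sup>2 * (norm (u - v))\<^sup>2 \<le> a * (norm ?q)\<^sup>2 + b * (norm ?p)\<^sup>2"
    using norm_sq_convex_combination_le[OF ab(1-3), of ?q "s *\<^sub>R (- v) - u"] combine[of u "- v"]
      norm_minus_commute[of "- (s *\<^sub>R v)" u]
    by (simp add: power_mult_distrib)
  moreover have "a * (norm ?p)\<^sup>2 + b * (norm ?q)\<^sup>2 + (a * (norm ?q)\<^sup>2 + b * (norm ?p)\<^sup>2)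
      = (a + b) * ((norm ?p)\<^sup>2 + (norm ?q)\<^sup>2)"
    by (simp add: algebra_simps)
  ultimately show ?thesis
    using ab(3) by (simp add: distrib_left)
qed

text \<open>For \<open>x = (u + v) / 2\<close> and \<open>y = (u - v) / 2\<close>, isosceles
  orthogonality says that \<open>u\<close> and \<open>v\<close> have equal norm, and the denominator
  is \<open>(norm u)\<^sup>2 = 1\<close>. The factor 4 comes from the halves in \<open>x\<close> and
  \<open>y\<close>.\<close>

lemma unit_vectors_in_L_set:
  fixes u v :: "'a::real_normed_vector"
  assumes "norm u = 1" "norm v = 1"
  shows "((norm (u + (1 - 2 * t) *\<^sub>R v))\<^sup>2 + (norm (u - (1 - 2 * t) *\<^sub>R v))\<^sup>2) / 4
    \<in> L_set TYPE('a) t"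
proof -
  define x y where "x = (1/2) *\<^sub>R (u + v)" and "y = (1/2) *\<^sub>R (u - v)"
  let ?s = "1 - 2 * t"
  have sum: "x + y = u" and diff: "x - y = v"
    by (simp_all add: x_def y_def flip: scaleR_add_right scaleR_diff_right)
  have "2 *\<^sub>R (t *\<^sub>R x + (1 - t) *\<^sub>R y) = (x + y) - ?s *\<^sub>R (x - y)"
    "2 *\<^sub>R ((1 - t) *\<^sub>R x + t *\<^sub>R y) = (x + y) + ?s *\<^sub>R (x - y)"
    by (simp_all add: algebra_simps scaleR_2 flip: scaleR_scaleR)
  then have "2 * norm (t *\<^sub>R x + (1 - t) *\<^sub>R y) = norm (u - ?s *\<^sub>R v)"
    "2 * norm ((1 - t) *\<^sub>R x + t *\<^sub>R y) = norm (u + ?s *\<^sub>R v)"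
    unfolding sum diff by (metis norm_scaleR abs_numeral)+
  then have "norm (u - ?s *\<^sub>R v) = 2 * norm (t *\<^sub>R x + (1 - t) *\<^sub>R y)"
    "norm (u + ?s *\<^sub>R v) = 2 * norm ((1 - t) *\<^sub>R x + t *\<^sub>R y)"
    by simp_all
  then have "((norm (u + ?s *\<^sub>R v))\<^sup>2 + (norm (u - ?s *\<^sub>R v))\<^sup>2) / 4
      = ((norm (t *\<^sub>R x + (1 - t) *\<^sub>R y))\<^sup>2 + (norm ((1 - t) *\<^sub>R x + t *\<^sub>R y))\<^sup>2)
        / (norm (x + y))\<^sup>2"
    using assms by (simp add: sum power_mult_distrib)
  moreover have "(x, y) \<noteq> (0, 0)"
    using sum assms by auto
  moreover have "x \<bottom>\<^sub>I y"
    using sum diff assms by (simp add: isosceles_orthogonal_def)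
  ultimately show ?thesis
    unfolding L_set_def by blast
qed

theorem proposition5:
  fixes t :: real
  assumes "dim_at_least TYPE('a::banach) 2"
    and "0 \<le> t" and "t < 1/2"
  shows "L_const TYPE('a) t \<ge> (4 * t\<^sup>2 - 4 * t + 1) * CNJ' TYPE('a)"
proof -
  define s where "s = 1 - 2 * t"
  have s: "0 < s" "s \<le> 1"
    using assms(2,3) by (simp_all add: s_def)
  \<comment> \<open>An independent set consists of nonzero vectors; one of them makes
    \<open>CNJ'_set\<close> nonempty, as \<open>cSup_least\<close> requires.\<close>
  obtain B :: "'a set" where B: "card B = 2" "independent B"
    using assms(1) by (auto simp: dim_at_least_def)
  then obtain b where "b \<in> B"
    by (metis card.empty ex_in_conv zero_neq_numeral)
  moreover have "0 \<notin> B"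
    using B(2) dependent_zero[of B] by auto
  ultimately have "\<exists>x :: 'a. x \<noteq> 0"
    by metis
  then have "CNJ'_set TYPE('a) \<noteq> {}"
    by (rule CNJ'_set_nonempty)
  \<comment> \<open>Division by \<open>s\<^sup>2\<close>, positive since \<open>t < 1/2\<close>,
    gives an upper bound for all elements of \<open>CNJ'_set\<close>.\<close>
  then have "CNJ' TYPE('a) \<le> L_const TYPE('a) t / s\<^sup>2"
    unfolding CNJ'_def
  proof (rule cSup_least)
    fix r
    assume "r \<in> CNJ'_set TYPE('a)"
    then obtain u v :: 'a where n: "norm u = 1" "norm v = 1"
      and r: "r = ((norm (u + v))\<^sup>2 + (norm (u - v))\<^sup>2) / 4"
      by (auto simp: CNJ'_set_def)
    have "s\<^sup>2 * r \<le> ((norm (u + s *\<^sub>R v))\<^sup>2 + (norm (u - s *\<^sub>R v))\<^sup>2) / 4"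
      using scaled_norm_sq_sum_le[of s u v] s by (simp add: r)
    also have "\<dots> \<le> L_const TYPE('a) t"
      unfolding L_const_def s_def
      by (intro cSup_upper unit_vectors_in_L_set n bdd_above_L_set assms(2,3))
    finally show "r \<le> L_const TYPE('a) t / s\<^sup>2"
      using s by (simp add: pos_le_divide_eq mult.commute)
  qed
  then have "s\<^sup>2 * CNJ' TYPE('a) \<le> L_const TYPE('a) t"
    using s by (simp add: pos_le_divide_eq mult.commute)
  moreover have "s\<^sup>2 = 4 * t\<^sup>2 - 4 * t + 1"
    by (simp add: s_def power2_eq_square algebra_simps)
  ultimately show ?thesis
    by simp
qed

end
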